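(* Let $k \geq 1$ be an integer, let $0 < c \leq 1$ be a real number, and let $(X_n)_{n \geq 1}$ be a family of graphs such that, for each $n$, the graph $X_n$ has $n$ vertices, all of degree at most $k$, and satisfies $|\partial A| \geq c|A|$ for every set $A$ of vertices of $X_n$ with $|A| \leq \frac{n}{2}$. For each $n \geq 2\frac{(k+3)^2}{c(k+2)}$, let $X'_n$ be a connected $k$-regular graph that contains $X_n$ as a subgraph and whose number of vertices $n'$ satisfies $n \leq n' \leq n + k + 2$. Then for every $n \geq 2\frac{(k+3)^2}{c(k+2)}$, the graph $X'_n$ is an $\left(n', k, \frac{c}{k+3}\right)$-fixed-expander.
   Context: All graphs are finite and simple (no loops or multiple edges). For a graph $X = (V,E)$ and $A \subseteq V$, $\partial A = \{ v \in V : d(A, v) = 1 \}$ is the set of vertices not in $A$ that are adjacent to at least one vertex of $A$. A $k$-regular graph $X = (V,E)$ with $n$ vertices is an $(n,k,c)$-fixed-expander if $|\partial A| \geq c|A|$ for all $A \subseteq V$ with $|A| \leq \frac{n}{2}$. "Subgraph" does not mean induced subgraph. *)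

theory Defs
  imports Complex_Main "Graph_Theory.Digraph_Component"
begin

text \<open>
  A finite simple graph is a \<^locale>\<open>pair_graph\<close>: a finite, loop-free, symmetric digraph whose arcs
  are ordered pairs of vertices, so that an undirected edge between \<open>u\<close> and \<open>v\<close> is the pair of arcs
  \<open>(u, v)\<close>, \<open>(v, u)\<close>. The degree of a vertex is therefore its \<^const>\<open>out_degree\<close>.
\<close>

definition regular_graph :: "nat \<Rightarrow> 'a pair_pre_digraph \<Rightarrow> bool" where
  "regular_graph k G \<longleftrightarrow> pair_graph G \<and> (\<forall>v \<in> pverts G. out_degree G v = k)"

text \<open>The vertices at distance exactly 1 from \<open>A\<close>.\<close>

definition vertex_boundary :: "'a pair_pre_digraph \<Rightarrow> 'a set \<Rightarrow> 'a set" where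
  "vertex_boundary G A = {v \<in> pverts G. v \<notin> A \<and> (\<exists>u \<in> A. u \<rightarrow>\<^bsub>G\<^esub> v)}"

definition vertex_expanding :: "real \<Rightarrow> 'a pair_pre_digraph \<Rightarrow> bool" where
  "vertex_expanding c G \<longleftrightarrow>
     (\<forall>A \<subseteq> pverts G. real (card A) \<le> real (card (pverts G)) / 2 \<longrightarrow>
        real (card (vertex_boundary G A)) \<ge> c * real (card A))"

definition fixed_expander :: "nat \<Rightarrow> nat \<Rightarrow> real \<Rightarrow> 'a pair_pre_digraph \<Rightarrow> bool" where
  "fixed_expander n k c G \<longleftrightarrow>
     regular_graph k G \<and> card (pverts G) = n \<and> vertex_expanding c G"

end

theory Submission
  imports Defs
begin

text \<open>
  For \<open>A\<close> in the regular supergraph \<open>H\<close> of \<open>G\<close>, the boundary of \<open>A\<close> in \<open>H\<close> contains the boundary of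
  \<open>A \<inter> V(G)\<close> in \<open>G\<close>. If \<open>A\<close> meets \<open>G\<close> in between 1 and \<open>n/2\<close> vertices, the at most \<open>k + 2\<close> new
  vertices enlarge \<open>A\<close> by at most a factor \<open>k + 3\<close>. If \<open>A\<close> misses \<open>G\<close>, then \<open>|A| \<le> k + 2\<close> and
  connectivity provides the one boundary vertex needed. If \<open>A\<close> contains more than \<open>n/2\<close> vertices of
  \<open>G\<close>, expand a subset of size \<open>\<lfloor>n/2\<rfloor>\<close>; at most \<open>(k + 3)/2\<close> boundary vertices are lost to the rest of \<open>A\<close>,
  which the lower bound on \<open>n\<close> absorbs.
\<close>

lemma finite_vertex_boundary:
  assumes "finite (pverts G)"
  shows "finite (vertex_boundary G A)"
  using assms by (simp add: vertex_boundary_def)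

lemma vertex_boundary_subgraph:
  fixes G H :: "'a pair_pre_digraph"
  assumes "subgraph G H"
  shows "vertex_boundary G (A \<inter> pverts G) \<subseteq> vertex_boundary H A"
proof -
  have "pverts G \<subseteq> pverts H" "parcs G \<subseteq> parcs H"
    using assms by (auto simp: subgraph_def)
  then show ?thesis
    by (auto simp: vertex_boundary_def arcs_ends_def arc_to_ends_def)
qed

text \<open>A neighbour of \<open>B\<close> outside \<open>B\<close> is either outside
  \<open>A\<close>, hence in the boundary of \<open>A\<close>, or in \<open>A - B\<close>. This
  bounds the loss when a large set is replaced by a subset small enough to expand.\<close>

lemma vertex_boundary_subset_Un:
  assumes "B \<subseteq> A"
  shows "vertex_boundary G B \<subseteq> vertex_boundary G A \<union> (A - B)"
  using assms by (auto simp: vertex_boundary_def)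

text \<open>A set with empty boundary is closed under adjacency, so no path leaves it.\<close>

lemma connected_vertex_boundary_nonempty:
  fixes G :: "'a pair_pre_digraph"
  assumes "pair_graph G" "connected G" "A \<subset> pverts G" "A \<noteq> {}"
  shows "vertex_boundary G A \<noteq> {}"
proof
  assume empty: "vertex_boundary G A = {}"
  interpret pair_graph G by fact
  obtain u v where u: "u \<in> A" and v: "v \<in> pverts G" "v \<notin> A"
    using assms by blast
  have "strongly_connected G"
    using assms(2) by (simp add: symmetric_connected_imp_strongly_connected sym_arcs)
  then have "u \<rightarrow>\<^sup>*\<^bsub>G\<^esub> v"
    using u v assms(3) by (auto simp: strongly_connected_def)
  then have "v \<in> A"
    using u
  proof (induction rule: reachable_induct)
    case base
    then show ?case by simp
  next
    case (step x y)
    then show ?case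
      using empty adj_in_verts(2)[of x y] by (auto simp: vertex_boundary_def)
  qed
  with v show False by simp
qed

text \<open>The parameter \<open>r\<close> bounds the number of added vertices. The theorem is the
  case \<open>r = k + 2\<close>, where \<open>large\<close> is its lower bound on n with the
  denominator cleared.\<close>

lemma expanding_supergraph:
  fixes G H :: "'a pair_pre_digraph"
  assumes G: "vertex_expanding c G" and c: "0 < c" "c \<le> 1"
    and H: "pair_graph H" "connected H" and sub: "subgraph G H"
    and G_ne: "pverts G \<noteq> {}"
    and few: "card (pverts H) \<le> card (pverts G) + r"
    and large: "c * (real r * real (card (pverts G))) \<ge> 2 * (real r + 1)^2"
  shows "vertex_expanding (c / (real r + 1)) H"
  unfolding vertex_expanding_def
proof (intro allI impI)
  fix A
  assume A: "A \<subseteq> pverts H" and half: "real (card A) \<le> real (card (pverts H)) / 2"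
  define n where "n = card (pverts G)"
  define A1 where "A1 = A \<inter> pverts G"
  define b where "b = card (vertex_boundary H A)"
  interpret H: pair_graph H by fact
  note finH = H.pair_finite_verts
  have VGH: "pverts G \<subseteq> pverts H"
    using sub by (auto simp: subgraph_def)
  have finG: "finite (pverts G)" and finA: "finite A" and finA1: "finite A1"
    using finite_subset[OF VGH finH] finite_subset[OF A finH] by (auto simp: A1_def)
  have "card (pverts H - pverts G) \<le> r"
    using few by (simp add: card_Diff_subset finG VGH)
  moreover have "card (A - pverts G) \<le> card (pverts H - pverts G)"
    using A finH by (intro card_mono) auto
  ultimately have new: "card (A - pverts G) \<le> r"
    by linarith
  have "card A = card A1 + card (A - pverts G)"
    using card_Int_Diff[OF finA] by (simp add: A1_def)
  then have cardA: "card A \<le> card A1 + r" and A1_le: "card A1 \<le> card A"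
    using new by linarith+
  have bd: "card (vertex_boundary G A1) \<le> b"
    unfolding b_def A1_def
    using vertex_boundary_subgraph[OF sub] finite_vertex_boundary[OF finH] by (rule card_mono[rotated])
  have G_exp: "c * card B \<le> card (vertex_boundary G B)"
    if "B \<subseteq> pverts G" "real (card B) \<le> real n / 2" for B
    using G that by (auto simp: vertex_expanding_def n_def)
  consider "A = {}" | "A \<noteq> {}" "A1 = {}" | "A1 \<noteq> {}" "real (card A1) \<le> n / 2"
    | "real (card A1) > n / 2"
    by linarith
  then have "c * real (card A) \<le> real b * (real r + 1)"
  proof cases
    case 1
    then show ?thesis by simp
  next
    case 2
    \<comment> \<open>\<open>A\<close> is proper because it misses the nonempty set
      \<open>pverts G\<close>.\<close>
    then have "A \<subset> pverts H"
      using A G_ne VGH by (auto simp: A1_def)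
    then have "vertex_boundary H A \<noteq> {}"
      using connected_vertex_boundary_nonempty[OF H] 2(1) by blast
    then have "b \<ge> 1"
      using finite_vertex_boundary[OF finH] by (simp add: b_def Suc_le_eq card_gt_0_iff)
    have "c * card A \<le> 1 * real r"
      using c cardA 2 by (intro mult_mono) auto
    also have "\<dots> \<le> b * (real r + 1)"
      using \<open>b \<ge> 1\<close> mult_mono[of 1 "real b" "real r" "real r + 1"] by simp
    finally show ?thesis .
  next
    case 3
    then have "card A1 \<ge> 1"
      using finA1 by (simp add: Suc_le_eq card_gt_0_iff)
    \<comment> \<open>Since \<open>A1\<close> is nonempty, the additive excess \<open>r\<close>
      becomes the factor \<open>r + 1\<close>.\<close>
    then have "real r * 1 \<le> real r * card A1"
      by (intro mult_left_mono) auto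
    then have "card A \<le> card A1 * (real r + 1)"
      using cardA by (simp add: algebra_simps)
    then have "c * card A \<le> c * card A1 * (real r + 1)"
      using c by (simp add: mult.assoc)
    also have "\<dots> \<le> b * (real r + 1)"
      using G_exp[of A1] bd 3 by (intro mult_right_mono) (auto simp: A1_def)
    finally show ?thesis .
  next
    case 4
    define m where "m = n div 2"
    \<comment> \<open>The second bound covers odd \<open>n\<close>: rounding down costs at most 1/2,
      so m \<ge> (n - 1)/2.\<close>
    have m: "2 * real m \<le> real n" "real n \<le> 2 * real m + 1"
      unfolding m_def by linarith+
    have m_le: "m \<le> card A1"
      using 4 m by linarith
    then obtain B where B: "B \<subseteq> A1" "card B = m"
      using obtain_subset_with_card_n by metis
    have "card (vertex_boundary G B) \<le> card (vertex_boundary G A1 \<union> (A1 - B))"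
      using vertex_boundary_subset_Un[OF B(1)] finite_vertex_boundary[OF finG] finA1
      by (intro card_mono) auto
    also have "\<dots> \<le> card (vertex_boundary G A1) + card (A1 - B)"
      by (rule card_Un_le)
    also have "card (A1 - B) = card A1 - m"
      using B finA1 finite_subset by (subst card_Diff_subset) auto
    finally have "real (card (vertex_boundary G B)) \<le> b + (card A1 - real m)"
      using bd m_le by linarith
    moreover have "c * real m \<le> card (vertex_boundary G B)"
      using G_exp[of B] B m by (auto simp: A1_def)
    moreover have "c * real m \<ge> c * ((real n - 1) / 2)"
      using c m by (intro mult_left_mono) auto
    moreover have A_le: "real (card A) \<le> (real n + r) / 2"
      using half few by (simp add: n_def)
    \<comment> \<open>This is (n + r)/2 - (n - 1)/2.\<close>
    moreover have "card A1 - real m \<le> (real r + 1) / 2"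
      using A_le of_nat_mono[OF A1_le, where 'a = real] m(2) by argo
    ultimately have "b \<ge> c * ((real n - 1) / 2) - (real r + 1) / 2"
      by argo
    then have "b * (real r + 1) \<ge> (c * ((real n - 1) / 2) - (real r + 1) / 2) * (real r + 1)"
      by (intro mult_right_mono) auto
    moreover have "c * card A \<le> c * ((real n + r) / 2)"
      using c A_le by (intro mult_left_mono) auto
    \<comment> \<open>After doubling and cancelling, the goal follows from c r n \<ge> (r + 1)^2 + c
      (2 r + 1). This bound on the last term explains the factor 2 in \<open>large\<close>.\<close>
    moreover have "c * (2 * real r + 1) \<le> 1 * (real r + 1)^2"
      using c by (intro mult_mono) (auto simp: power2_eq_square algebra_simps)
    ultimately show ?thesis
      using large[folded n_def] by (simp add: field_simps power2_eq_square)
  qed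
  then show "c / (real r + 1) * card A \<le> card (vertex_boundary H A)"
    by (simp add: b_def field_simps)
qed

theorem propositionA5:
  fixes k :: nat and c :: real
    and X X' :: "nat \<Rightarrow> 'a pair_pre_digraph"
    and n' :: "nat \<Rightarrow> nat"
  assumes "k \<ge> 1" and "0 < c" and "c \<le> 1"
    and "\<And>n. n \<ge> 1 \<Longrightarrow> pair_graph (X n)"
    and "\<And>n. n \<ge> 1 \<Longrightarrow> card (pverts (X n)) = n"
    and "\<And>n v. n \<ge> 1 \<Longrightarrow> v \<in> pverts (X n) \<Longrightarrow> out_degree (X n) v \<le> k"
    and "\<And>n. n \<ge> 1 \<Longrightarrow> vertex_expanding c (X n)"
    and "\<And>n. real n \<ge> 2 * ((real k + 3)^2 / (c * (real k + 2))) \<Longrightarrow>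
           regular_graph k (X' n) \<and> connected (X' n) \<and> subgraph (X n) (X' n) \<and>
           card (pverts (X' n)) = n' n \<and> n \<le> n' n \<and> n' n \<le> n + k + 2"
  shows "\<forall>n. real n \<ge> 2 * ((real k + 3)^2 / (c * (real k + 2))) \<longrightarrow>
           fixed_expander (n' n) k (c / (real k + 3)) (X' n)"
proof (intro allI impI)
  fix n :: nat
  assume n: "real n \<ge> 2 * ((real k + 3)^2 / (c * (real k + 2)))"
  note X' = assms(8)[OF n]
  \<comment> \<open>A positive threshold excludes n = 0, where nothing is assumed about
    \<open>X n\<close>.\<close>
  have "2 * ((real k + 3)^2 / (c * (real k + 2))) > 0"
    using \<open>0 < c\<close> by (intro mult_pos_pos divide_pos_pos) auto
  then have "n \<ge> 1"
    using n by linarith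
  note card_X = assms(5)[OF this]
  have "c * (real k + 2) > 0"
    using \<open>0 < c\<close> by simp
  then have "2 * (real k + 3)^2 \<le> c * ((real k + 2) * n)"
    using n by (simp add: pos_divide_le_eq mult_ac)
  then have "vertex_expanding (c / (real (k + 2) + 1)) (X' n)"
    using assms(2,3,7) X' card_X \<open>n \<ge> 1\<close>
    by (intro expanding_supergraph[where G = "X n"]) (auto simp: regular_graph_def add.commute)
  then show "fixed_expander (n' n) k (c / (real k + 3)) (X' n)"
    using X' by (simp add: fixed_expander_def add.commute)
qed

end
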